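(* Let $G$ be a well-partitioned chordal graph. If $G$ is a comparability graph, then $\mathcal{R}^p(G)\le 4$.
   Context: All graphs are finite, simple and connected. A comparability graph is a graph admitting a transitive orientation. A graph $G=(V,E)$ is permutationally $k$-representable if there is a word $w=p_1p_2\cdots p_k$, each $p_i$ a permutation of $V$, such that for all distinct $a,b\in V$, $ab\in E$ if and only if $a$ and $b$ alternate in $w$ (the subsequence of $w$ consisting of all occurrences of $a$ and $b$ is of the form $abab\cdots$ or $baba\cdots$). The permutation-representation number $\mathcal{R}^p(G)$ of a comparability graph $G$ is the smallest $k$ such that $G$ is permutationally $k$-representable. A connected graph $G=(V,E)$ is a well-partitioned chordal graph if there exist a partition $\mathcal{P}$ of $V$ and a tree $\mathcal{T}$ with vertex set $\mathcal{P}$ such that: (1) each part is a clique of $G$; (2) for every edge $AB$ of $\mathcal{T}$ there exist $A'\subseteq A$, $B'\subseteq B$ such that the edges of $G$ between $A$ and $B$ are exactly the pairs in $A'\times B'$; (3) for distinct parts $A,B$ not adjacent in $\mathcal{T}$ there are no edges of $G$ between $A$ and $B$. *)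

theory Defs
  imports
    "Graph_Theory.Graph_Theory"
    "HOL-Library.Disjoint_Sets"
    "HOL-Library.Extended_Nat"
    "HOL-Combinatorics.Multiset_Permutations"
begin

text \<open>
  A finite simple undirected graph is a \<^locale>\<open>pair_graph\<close>: a finite vertex set with a symmetric,
  irreflexive edge relation \<^const>\<open>parcs\<close>, so that \<open>ab\<close> is an edge iff \<open>(a, b) \<in> parcs G\<close>.
\<close>

definition connected_graph :: "'a pair_pre_digraph \<Rightarrow> bool" where
  "connected_graph G \<longleftrightarrow> pair_graph G \<and> Digraph_Component.connected (with_proj G)"

text \<open>
  \<^const>\<open>Digraph_Component.tree\<close> is unsuitable here: it forbids all directed cycles, and in a
  symmetric digraph every edge \<open>uv\<close> gives the directed cycle \<open>u, v, u\<close>.  The cycles of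
  the undirected graph are the directed cycles of length at least 3.
\<close>

definition undirected_tree :: "'a pair_pre_digraph \<Rightarrow> bool" where
  "undirected_tree T \<longleftrightarrow>
     connected_graph T \<and> \<not> (\<exists>p. pre_digraph.cycle (with_proj T) p \<and> 3 \<le> length p)"

definition transitive_orientation :: "'a pair_pre_digraph \<Rightarrow> 'a rel \<Rightarrow> bool" where
  "transitive_orientation G D \<longleftrightarrow>
     D \<union> D\<inverse> = parcs G \<and> D \<inter> D\<inverse> = {} \<and> trans D"

definition comparability_graph :: "'a pair_pre_digraph \<Rightarrow> bool" where
  "comparability_graph G \<longleftrightarrow> pair_graph G \<and> (\<exists>D. transitive_orientation G D)"

definition is_clique :: "'a pair_pre_digraph \<Rightarrow> 'a set \<Rightarrow> bool" where
  "is_clique G A \<longleftrightarrow>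
     A \<subseteq> pverts G \<and> (\<forall>a\<in>A. \<forall>b\<in>A. a \<noteq> b \<longrightarrow> (a, b) \<in> parcs G)"

definition edges_between :: "'a pair_pre_digraph \<Rightarrow> 'a set \<Rightarrow> 'a set \<Rightarrow> 'a rel" where
  "edges_between G A B = parcs G \<inter> (A \<times> B)"

definition well_partitioned_chordal :: "'a pair_pre_digraph \<Rightarrow> bool" where
  "well_partitioned_chordal G \<longleftrightarrow>
     connected_graph G \<and>
     (\<exists>P T. partition_on (pverts G) P \<and> undirected_tree T \<and> pverts T = P \<and>
        (\<forall>A\<in>P. is_clique G A) \<and>
        (\<forall>A B. (A, B) \<in> parcs T \<longrightarrow>
           (\<exists>A' B'. A' \<subseteq> A \<and> B' \<subseteq> B \<and> edges_between G A B = A' \<times> B')) \<and>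
        (\<forall>A\<in>P. \<forall>B\<in>P. A \<noteq> B \<and> (A, B) \<notin> parcs T \<longrightarrow> edges_between G A B = {}))"

definition alternating_word :: "'a \<Rightarrow> 'a \<Rightarrow> nat \<Rightarrow> 'a list" where
  "alternating_word a b n = map (\<lambda>i. if even i then a else b) [0..<n]"

definition alternate :: "'a \<Rightarrow> 'a \<Rightarrow> 'a list \<Rightarrow> bool" where
  "alternate a b w \<longleftrightarrow>
     (\<exists>n. filter (\<lambda>x. x = a \<or> x = b) w \<in> {alternating_word a b n, alternating_word b a n})"

definition permutationally_representable :: "nat \<Rightarrow> 'a pair_pre_digraph \<Rightarrow> bool" where
  "permutationally_representable k G \<longleftrightarrow>
     k \<ge> 1 \<and>
     (\<exists>ps. length ps = k \<and> set ps \<subseteq> permutations_of_set (pverts G) \<and>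
        (\<forall>a\<in>pverts G. \<forall>b\<in>pverts G. a \<noteq> b \<longrightarrow>
           ((a, b) \<in> parcs G \<longleftrightarrow> alternate a b (concat ps))))"

text \<open>
  The infimum in \<^typ>\<open>enat\<close> is the least such \<open>k\<close> if there is one, and \<open>\<infinity>\<close> if \<open>G\<close> is not
  permutationally representable; an upper bound by a number thus includes representability.
\<close>

definition permutation_representation_number :: "'a pair_pre_digraph \<Rightarrow> enat" where
  "permutation_representation_number G =
     (INF k\<in>{k. permutationally_representable k G}. enat k)"

end

theory Submission
  imports Defs "HOL-Library.Product_Lexorder"
begin

text \<open>
  Number the parts of the tree so that every part is adjacent to at most one part with a smaller
  number, its parent.  Fix a transitive orientation \<open>D\<close>, read as a strict order; every part is a
  chain.  After merging adjacent parts whose union is a clique and making a part squeezed between two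
  vertices of a neighbouring part \<open>B\<close> a child of \<open>B\<close>, four linear extensions of \<open>D\<close> reverse all
  incomparable pairs.

  In the first two, every part \<open>A\<close> is split into its vertices with an upper neighbour outside \<open>A\<close>
  followed by the others, and everything below \<open>A\<close> in the tree is placed in the gap between the two
  pieces; the two extensions list the subtrees in opposite orders, so pairs from unrelated parts
  are reversed.  The third puts each part before its descendants, except for the vertices that lie
  under a vertex \<open>a\<close> of the parent part, which are placed just before the lowest such \<open>a\<close>.  It
  corrects the pairs of a vertex of the upper piece with a vertex in a descendant part.  The
  fourth is the dual of the third and corrects the lower piece.
\<close>

section \<open>Linear extensions and alternation\<close>

definition precedes :: "'a list \<Rightarrow> 'a \<Rightarrow> 'a \<Rightarrow> bool" where
  "precedes p a b \<longleftrightarrow> filter (\<lambda>x. x = a \<or> x = b) p = [a, b]"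

lemma filter_doubleton_commute:
  "filter (\<lambda>x. x = b \<or> x = a) p = filter (\<lambda>x. x = a \<or> x = b) p"
  by (rule filter_cong) auto

lemma precedes_rev: "precedes (rev p) a b \<longleftrightarrow> precedes p b a"
  unfolding precedes_def rev_filter[symmetric] filter_doubleton_commute[of b a]
  by (metis rev.simps append.simps rev_rev_ident)

lemma precedes_asym: "precedes p a b \<Longrightarrow> a \<noteq> b \<Longrightarrow> \<not> precedes p b a"
  unfolding precedes_def filter_doubleton_commute[of b a] by simp

lemma permutation_precedes_total:
  assumes "p \<in> permutations_of_set V" "a \<in> V" "b \<in> V" "a \<noteq> b"
  shows "precedes p a b \<or> precedes p b a"
proof -
  let ?ys = "filter (\<lambda>x. x = a \<or> x = b) p"
  have set: "set ?ys = {a, b}" and "distinct ?ys"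
    using assms by (auto dest: permutations_of_setD)
  then have "length ?ys = 2"
    using assms(4) by (metis distinct_card card_2_iff)
  then obtain c d where "?ys = [c, d]"
    by (metis (no_types, lifting) One_nat_def Suc_1 length_0_conv length_Suc_conv)
  with set show ?thesis
    unfolding precedes_def filter_doubleton_commute[of b a] by (auto simp: doubleton_eq_iff)
qed

lemma sorted_map_imp_precedes:
  fixes key :: "'a \<Rightarrow> 'k::linorder"
  assumes "p \<in> permutations_of_set V" "sorted (map key p)" "a \<in> V" "b \<in> V" "key a < key b"
  shows "precedes p a b"
proof (rule ccontr)
  assume "\<not> precedes p a b"
  then have "precedes p b a"
    using permutation_precedes_total[OF assms(1,3,4)] assms(5) by auto
  moreover have "sorted (map key (filter (\<lambda>x. x = b \<or> x = a) p))"
    using assms(2) by (rule sorted_filter)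
  ultimately show False
    using assms(5) by (simp add: precedes_def)
qed

definition linear_extension :: "'a set \<Rightarrow> 'a rel \<Rightarrow> 'a list \<Rightarrow> bool" where
  "linear_extension V D p \<longleftrightarrow> p \<in> permutations_of_set V \<and> (\<forall>(a, b)\<in>D. precedes p a b)"

lemma linear_extension_rev: "linear_extension V (D\<inverse>) p \<Longrightarrow> linear_extension V D (rev p)"
  by (auto simp: linear_extension_def precedes_rev permutations_of_set_def)

lemma ex_linear_extension_refining:
  fixes key :: "'a \<Rightarrow> 'k::linorder"
  assumes "finite V" "D \<subseteq> V \<times> V" "trans D" "irrefl D"
    and mono: "\<And>a b. (a, b) \<in> D \<Longrightarrow> key a \<le> key b"
  obtains p where "linear_extension V D p"
    and "\<And>a b. \<lbrakk>a \<in> V; b \<in> V; key a < key b\<rbrakk> \<Longrightarrow> precedes p a b"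
proof -
  define height where "height v = card (D\<inverse> `` {v})" for v
  let ?key = "\<lambda>v. (key v, height v)"
  obtain xs where xs: "set xs = V" "distinct xs"
    using finite_distinct_list[OF assms(1)] by blast
  define p where "p = sort_key ?key xs"
  have p: "p \<in> permutations_of_set V" "sorted (map ?key p)"
    using xs by (auto simp: p_def intro: permutations_of_setI)
  note precedesI = sorted_map_imp_precedes[OF p]
  have "height a < height b" if "(a, b) \<in> D" for a b
    unfolding height_def
  proof (rule psubset_card_mono)
    show "finite (D\<inverse> `` {b})"
      using assms(1,2) by (auto intro: finite_subset[of _ V])
    show "D\<inverse> `` {a} \<subset> D\<inverse> `` {b}"
      using that assms(3,4) by (auto dest: transD simp: irrefl_def)
  qed
  then have "precedes p a b" if "(a, b) \<in> D" for a b
    using that mono[OF that] assms(2) by (auto intro!: precedesI)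
  then have "linear_extension V D p"
    using p(1) by (auto simp: linear_extension_def)
  then show thesis
    using that precedesI by simp
qed

definition realizer :: "'a set \<Rightarrow> 'a rel \<Rightarrow> 'a list list \<Rightarrow> bool" where
  "realizer V D ps \<longleftrightarrow> (\<forall>p\<in>set ps. linear_extension V D p) \<and>
    (\<forall>a\<in>V. \<forall>b\<in>V. a \<noteq> b \<longrightarrow> (a, b) \<notin> D \<longrightarrow> (b, a) \<notin> D \<longrightarrow> (\<exists>p\<in>set ps. precedes p a b))"

lemma alternating_word_Suc_Suc:
  "alternating_word a b (Suc (Suc n)) = a # b # alternating_word a b n"
proof -
  have "[0..<Suc (Suc n)] = 0 # 1 # map (\<lambda>i. Suc (Suc i)) [0..<n]"
    by (simp add: upt_conv_Cons map_Suc_upt[symmetric] o_def del: upt_Suc)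
  then show ?thesis
    by (simp add: alternating_word_def o_def del: upt_Suc)
qed

lemma alternating_word_neq_Cons: "a \<noteq> b \<Longrightarrow> alternating_word a b n \<noteq> b # w"
  by (cases n) (auto simp: alternating_word_def upt_conv_Cons simp del: upt_Suc)

lemma ex_alternating_word_Cons_Cons:
  "(\<exists>n. a # b # w = alternating_word a b n) \<longleftrightarrow> (\<exists>n. w = alternating_word a b n)"
  (is "?long \<longleftrightarrow> ?short")
proof
  assume ?long
  then obtain n where n: "a # b # w = alternating_word a b n" ..
  then have "length (alternating_word a b n) \<ge> 2"
    by (metis length_Cons le_add1 add_2_eq_Suc)
  then have "n = Suc (Suc (n - 2))"
    by (simp add: alternating_word_def)
  then show ?short
    using n by (metis alternating_word_Suc_Suc list.inject)
next
  assume ?short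
  then show ?long
    by (metis alternating_word_Suc_Suc)
qed

lemma filter_concat_eq_alternating_word_iff:
  assumes "a \<noteq> b" "\<forall>p\<in>set ps. precedes p a b \<or> precedes p b a"
  shows "(\<exists>n. filter (\<lambda>x. x = a \<or> x = b) (concat ps) = alternating_word a b n) \<longleftrightarrow>
    (\<forall>p\<in>set ps. precedes p a b)"
  using assms(2)
proof (induction ps)
  case Nil
  show ?case
    by (auto simp: alternating_word_def intro: exI[of _ 0])
next
  case (Cons p ps)
  let ?f = "filter (\<lambda>x. x = a \<or> x = b)"
  consider (before) "precedes p a b" | (after) "\<not> precedes p a b" "?f p = [b, a]"
    using Cons.prems unfolding precedes_def filter_doubleton_commute[of b a] by auto
  then show ?case
  proof cases
    case before
    then show ?thesis
      using Cons by (simp add: precedes_def ex_alternating_word_Cons_Cons)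
  next
    case after
    then show ?thesis
      using alternating_word_neq_Cons[OF assms(1)]
      by (metis append_Cons concat.simps(2) filter_append list.set_intros(1))
  qed
qed

lemma alternate_concat_iff:
  assumes "a \<noteq> b" "\<forall>p\<in>set ps. precedes p a b \<or> precedes p b a"
  shows "alternate a b (concat ps) \<longleftrightarrow>
    (\<forall>p\<in>set ps. precedes p a b) \<or> (\<forall>p\<in>set ps. precedes p b a)"
  using filter_concat_eq_alternating_word_iff[of a b ps]
    filter_concat_eq_alternating_word_iff[of b a ps] assms
  unfolding alternate_def filter_doubleton_commute[of b a] by blast

lemma realizer_imp_permutationally_representable:
  assumes D: "transitive_orientation G D" and ps: "realizer (pverts G) D ps" "ps \<noteq> []"
  shows "permutationally_representable (length ps) G"
proof -
  have permutations: "set ps \<subseteq> permutations_of_set (pverts G)"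
    and extends: "\<And>p a b. p \<in> set ps \<Longrightarrow> (a, b) \<in> D \<Longrightarrow> precedes p a b"
    using ps(1) by (auto simp: realizer_def linear_extension_def)
  have "(a, b) \<in> parcs G \<longleftrightarrow> alternate a b (concat ps)"
    if ab: "a \<in> pverts G" "b \<in> pverts G" "a \<noteq> b" for a b
  proof -
    have total: "\<forall>p\<in>set ps. precedes p a b \<or> precedes p b a"
      using permutation_precedes_total permutations ab by (metis subsetD)
    have "(a, b) \<in> parcs G \<longleftrightarrow> (a, b) \<in> D \<or> (b, a) \<in> D"
      using D by (auto simp: transitive_orientation_def)
    also have "\<dots> \<longleftrightarrow> (\<forall>p\<in>set ps. precedes p a b) \<or> (\<forall>p\<in>set ps. precedes p b a)"
      using extends ps(1) ab precedes_asym unfolding realizer_def by metis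
    finally show ?thesis
      using alternate_concat_iff[OF ab(3) total] by simp
  qed
  moreover have "length ps \<ge> 1"
    using ps(2) by (cases ps) auto
  ultimately show ?thesis
    unfolding permutationally_representable_def using permutations by blast
qed

section \<open>Nested intervals along a rooted tree\<close>

locale rooted_tree =
  fixes parent :: "nat \<Rightarrow> nat"
  assumes parent_less: "0 < k \<Longrightarrow> parent k < k"
begin

definition descent :: "nat rel" where
  "descent = {(parent k, k) | k. 0 < k}"

lemma descent_iff: "(i, k) \<in> descent \<longleftrightarrow> 0 < k \<and> i = parent k"
  by (auto simp: descent_def)

lemma trancl_descent_less: "(i, k) \<in> descent\<^sup>+ \<Longrightarrow> i < k"
  by (induction rule: trancl_induct) (auto simp: descent_iff dest: parent_less)

lemma trancl_descent_le_parent: "(i, k) \<in> descent\<^sup>+ \<Longrightarrow> i \<le> parent k"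
  by (erule tranclE) (auto simp: descent_iff dest: trancl_descent_less)

lemma root_descent: "(0, k) \<in> descent\<^sup>*"
proof (induction k rule: less_induct)
  case (less k)
  show ?case
  proof (cases "k = 0")
    case False
    then have "(0, parent k) \<in> descent\<^sup>*" "(parent k, k) \<in> descent"
      using less parent_less by (auto simp: descent_iff)
    then show ?thesis by (rule rtrancl_into_rtrancl)
  qed simp
qed

text \<open>
  The subtree of \<open>k\<close> occupies the interval of radius \<open>(1/4) ^ k\<close> around \<open>centre s k\<close>; the children
  of \<open>k\<close> are arranged on one side of \<open>centre s k\<close>, in opposite orders for \<open>s = 1\<close> and \<open>s = -1\<close>.
\<close>

function centre :: "real \<Rightarrow> nat \<Rightarrow> real" where
  "centre s k = (if k = 0 then 0 else centre s (parent k) + 2 * s * (1/4) ^ k)"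
  by auto
termination
  by (relation "measure snd") (auto dest: parent_less)

declare centre.simps[simp del]

lemma centre_parent: "0 < k \<Longrightarrow> centre s k = centre s (parent k) + 2 * s * (1/4) ^ k"
  by (subst centre.simps) simp

lemma four_times_radius_le:
  assumes "i < k"
  shows "4 * (1/4::real) ^ k \<le> (1/4) ^ i"
proof -
  have "(1/4::real) ^ k \<le> (1/4) ^ Suc i"
    using assms by (intro power_decreasing) auto
  then show ?thesis by simp
qed

lemma intervals_strictly_nested:
  assumes "\<bar>s\<bar> = 1" "(i, k) \<in> descent\<^sup>+"
  shows "\<bar>centre s k - centre s i\<bar> + (1/4) ^ k < (1/4) ^ i"
proof -
  have child: "\<bar>centre s k - centre s i\<bar> + (1/4) ^ k < (1/4) ^ i" if "(i, k) \<in> descent" for i k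
  proof -
    from that have k: "0 < k" "i = parent k" by (auto simp: descent_iff)
    then have "\<bar>centre s k - centre s i\<bar> = 2 * (1/4) ^ k"
      using centre_parent[of k s] assms(1) by (simp add: abs_mult)
    moreover have "(0::real) < (1/4) ^ k" by simp
    ultimately show ?thesis
      using four_times_radius_le[OF parent_less[OF k(1)]] unfolding k(2) by linarith
  qed
  show ?thesis
    using assms(2)
  proof (induction rule: trancl_induct)
    case (base k)
    then show ?case by (rule child)
  next
    case (step j k)
    from child[OF step.hyps(2)] step.IH show ?case by linarith
  qed
qed

lemma intervals_nested:
  assumes "\<bar>s\<bar> = 1" "(i, k) \<in> descent\<^sup>*"
  shows "\<bar>centre s k - centre s i\<bar> + (1/4) ^ k \<le> (1/4) ^ i"
  using intervals_strictly_nested[OF assms(1), of i k] assms(2)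
  unfolding rtrancl_eq_or_trancl by auto

definition crossed :: "nat \<Rightarrow> nat \<Rightarrow> bool" where
  "crossed i k \<longleftrightarrow> centre 1 i + (1/4) ^ i < centre 1 k - (1/4) ^ k \<and>
    centre (-1) k + (1/4) ^ k < centre (-1) i - (1/4) ^ i"

lemma crossed_descent:
  assumes "crossed i k" "(i, i') \<in> descent\<^sup>*" "(k, k') \<in> descent\<^sup>*"
  shows "crossed i' k'"
  using assms(1) intervals_nested[of 1, OF _ assms(2)] intervals_nested[of 1, OF _ assms(3)]
    intervals_nested[of "-1", OF _ assms(2)] intervals_nested[of "-1", OF _ assms(3)]
  unfolding crossed_def by (simp, linarith)

lemma crossed_siblings:
  assumes "0 < m" "m < k" "parent m = parent k"
  shows "crossed k m"
proof -
  have "0 < k" using assms by simp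
  moreover have "(0::real) < (1/4) ^ k" by simp
  ultimately show ?thesis
    unfolding crossed_def centre_parent[OF assms(1)] centre_parent[OF \<open>0 < k\<close>] assms(3)
    using four_times_radius_le[OF assms(2)] by (intro conjI; linarith)
qed

lemma crossed_or_descent:
  assumes "i \<noteq> k" "(i, k) \<notin> descent\<^sup>+" "(k, i) \<notin> descent\<^sup>+"
  shows "crossed i k \<or> crossed k i"
  using assms
proof (induction k rule: less_induct)
  case (less k)
  have "0 < k"
    using root_descent[of i] less.prems by (auto simp: rtrancl_eq_or_trancl)
  then have k: "parent k < k" "(parent k, k) \<in> descent"
    by (auto simp: descent_iff parent_less)
  have "parent k \<noteq> i" "(i, parent k) \<notin> descent\<^sup>+"
    using k(2) less.prems(2) by (auto intro: trancl_into_trancl)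
  show ?case
  proof (cases "(parent k, i) \<in> descent\<^sup>+")
    case True
    then obtain m where m: "(parent k, m) \<in> descent" "(m, i) \<in> descent\<^sup>*"
      by (auto dest: tranclD)
    then have "m \<noteq> k"
      using less.prems(1,3) by (auto simp: rtrancl_eq_or_trancl)
    then have "crossed m k \<or> crossed k m"
      using crossed_siblings[of m k] crossed_siblings[of k m] m(1) \<open>0 < k\<close>
      by (auto simp: descent_iff neq_iff)
    then show ?thesis
      using crossed_descent m(2) by blast
  next
    case False
    then have "crossed i (parent k) \<or> crossed (parent k) i"
      using less.IH[OF k(1)] \<open>parent k \<noteq> i\<close> \<open>(i, parent k) \<notin> descent\<^sup>+\<close> by blast
    then show ?thesis
      using crossed_descent k(2) by blast
  qed
qed

end

section \<open>Layerings\<close>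

definition label_edges :: "'a rel \<Rightarrow> ('a \<Rightarrow> 'b) \<Rightarrow> 'b rel" where
  "label_edges E \<pi> = {(\<pi> u, \<pi> v) | u v. (u, v) \<in> E \<and> \<pi> u \<noteq> \<pi> v}"

lemma label_edgesI: "(u, v) \<in> E \<Longrightarrow> \<pi> u \<noteq> \<pi> v \<Longrightarrow> (\<pi> u, \<pi> v) \<in> label_edges E \<pi>"
  by (auto simp: label_edges_def)

lemma label_edgesE:
  assumes "(i, j) \<in> label_edges E \<pi>"
  obtains u v where "(u, v) \<in> E" "\<pi> u = i" "\<pi> v = j" "i \<noteq> j"
  using assms by (auto simp: label_edges_def)

lemma label_edges_compE:
  assumes "(i, j) \<in> label_edges E (f \<circ> \<pi>)"
  obtains m n where "(m, n) \<in> label_edges E \<pi>" "f m = i" "f n = j"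
proof -
  obtain u v where "(u, v) \<in> E" "f (\<pi> u) = i" "f (\<pi> v) = j" "i \<noteq> j"
    using assms by (auto elim: label_edgesE)
  then show thesis
    by (intro that[of "\<pi> u" "\<pi> v"]) (auto intro: label_edgesI)
qed

locale product_clique_partition =
  fixes V :: "'a set" and E :: "'a rel" and part :: "'a \<Rightarrow> 'b"
  assumes finite_V: "finite V"
    and E_subset: "E \<subseteq> V \<times> V"
    and sym_E: "(u, v) \<in> E \<Longrightarrow> (v, u) \<in> E"
    and same_part: "\<lbrakk>u \<in> V; v \<in> V; u \<noteq> v; part u = part v\<rbrakk> \<Longrightarrow> (u, v) \<in> E"
    and product: "\<lbrakk>(u, v) \<in> E; (u', v') \<in> E; part u = part u'; part v = part v'; part u \<noteq> part v\<rbrakk>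
      \<Longrightarrow> (u, v') \<in> E"
begin

lemma E_verts: "(u, v) \<in> E \<Longrightarrow> u \<in> V" "(u, v) \<in> E \<Longrightarrow> v \<in> V"
  using E_subset by auto

lemma label_edges_sym: "(i, j) \<in> label_edges E part \<Longrightarrow> (j, i) \<in> label_edges E part"
  by (auto elim!: label_edgesE intro!: label_edgesI sym_E)

lemma label_edges_image:
  "(i, j) \<in> label_edges E part \<Longrightarrow> i \<in> part ` V" "(i, j) \<in> label_edges E part \<Longrightarrow> j \<in> part ` V"
  using E_verts by (auto elim!: label_edgesE)

lemma product_clique_partition_relabel:
  assumes "inj_on f (part ` V)"
  shows "product_clique_partition V E (f \<circ> part)"
proof
  have part_eq_iff: "(f \<circ> part) u = (f \<circ> part) v \<longleftrightarrow> part u = part v" if "u \<in> V" "v \<in> V" for u v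
    using assms that by (simp add: inj_on_eq_iff)
  show "(u, v) \<in> E" if "u \<in> V" "v \<in> V" "u \<noteq> v" "(f \<circ> part) u = (f \<circ> part) v" for u v
    using that part_eq_iff same_part by blast
  show "(u, v') \<in> E" if arcs: "(u, v) \<in> E" "(u', v') \<in> E" and "(f \<circ> part) u = (f \<circ> part) u'"
    "(f \<circ> part) v = (f \<circ> part) v'" "(f \<circ> part) u \<noteq> (f \<circ> part) v" for u v u' v'
    using product[OF arcs] that(3-5) E_verts[OF arcs(1)] E_verts[OF arcs(2)] part_eq_iff by blast
qed (fact finite_V E_subset sym_E)+

end

text \<open>
  Label \<open>0\<close> carries no vertices: it is a virtual root, the parent of every label without adjacent
  smaller label.
\<close>

locale layered = product_clique_partition V E \<pi>
  for V :: "'a set" and E :: "'a rel" and \<pi> :: "'a \<Rightarrow> nat" +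
  assumes label_pos: "v \<in> V \<Longrightarrow> 0 < \<pi> v"
    and smaller_label_unique: "\<lbrakk>(i, k) \<in> label_edges E \<pi>; (j, k) \<in> label_edges E \<pi>; i < k; j < k\<rbrakk>
      \<Longrightarrow> i = j"
begin

lemma no_label_triangle:
  assumes "(i, j) \<in> label_edges E \<pi>" "(j, k) \<in> label_edges E \<pi>" "(i, k) \<in> label_edges E \<pi>"
  shows False
proof -
  have distinct: "i \<noteq> j" "j \<noteq> k" "i \<noteq> k"
    using assms by (auto elim: label_edgesE)
  then consider (k_top) "i < k" "j < k" | (j_top) "i < j" "k < j" | (i_top) "j < i" "k < i"
    by linarith
  then show False
  proof cases
    case k_top
    then show False
      using smaller_label_unique[OF assms(3,2)] distinct by blast
  next
    case j_top
    then show False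
      using smaller_label_unique[OF assms(1) label_edges_sym[OF assms(2)]] distinct by blast
  next
    case i_top
    then show False
      using smaller_label_unique[OF assms(1,3)[THEN label_edges_sym]] distinct by blast
  qed
qed

definition label_parent :: "nat \<Rightarrow> nat" where
  "label_parent k = Sup {i. (i, k) \<in> label_edges E \<pi> \<and> i < k}"

lemma label_parent_eq:
  assumes "(i, k) \<in> label_edges E \<pi>" "i < k"
  shows "label_parent k = i"
proof -
  have "{i. (i, k) \<in> label_edges E \<pi> \<and> i < k} = {i}"
    using smaller_label_unique assms by blast
  then show ?thesis
    by (simp add: label_parent_def)
qed

lemma label_parent_cases:
  obtains (root) "label_parent k = 0"
  | (edge) "(label_parent k, k) \<in> label_edges E \<pi>" "label_parent k < k"
proof (cases "\<exists>i. (i, k) \<in> label_edges E \<pi> \<and> i < k")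
  case True
  then show thesis
    using edge label_parent_eq by blast
next
  case False
  then have "{i. (i, k) \<in> label_edges E \<pi> \<and> i < k} = {}"
    by blast
  then have "label_parent k = 0"
    by (simp only: label_parent_def Sup_nat_empty)
  then show thesis by (rule root)
qed

sublocale rooted_tree label_parent
proof
  show "label_parent k < k" if "0 < k" for k
    using that by (cases k rule: label_parent_cases) auto
qed

lemma label_edge_descent:
  assumes "(i, k) \<in> label_edges E \<pi>" "i < k"
  shows "(i, k) \<in> descent"
  using label_parent_eq[OF assms] assms(2) by (auto simp: descent_iff)

lemma edge_label_cases:
  assumes "(u, v) \<in> E"
  obtains (same) "\<pi> u = \<pi> v"
  | (up) "\<pi> v < \<pi> u" "(\<pi> v, \<pi> u) \<in> descent"
  | (down) "\<pi> u < \<pi> v" "(\<pi> u, \<pi> v) \<in> descent"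
proof -
  consider "\<pi> u = \<pi> v" | "\<pi> v < \<pi> u" | "\<pi> u < \<pi> v"
    by linarith
  then show thesis
    using label_edge_descent[OF label_edgesI[OF assms]]
      label_edge_descent[OF label_edgesI[OF sym_E[OF assms]]]
    by cases (auto intro: that)
qed

end

locale layered_orientation = layered +
  fixes D :: "'a rel"
  assumes orientation: "D \<union> D\<inverse> = E"
    and antisymmetric: "D \<inter> D\<inverse> = {}"
    and trans_D: "trans D"
begin

lemma layered_orientation_converse: "layered_orientation V E \<pi> (D\<inverse>)"
  using orientation antisymmetric trans_D by unfold_locales auto

lemma E_cases: "(u, v) \<in> E \<Longrightarrow> (u, v) \<in> D \<or> (v, u) \<in> D"
  using orientation by auto

lemma D_imp_E: "(u, v) \<in> D \<Longrightarrow> (u, v) \<in> E" "(u, v) \<in> D \<Longrightarrow> (v, u) \<in> E"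
  using orientation by auto

lemma D_verts: "(u, v) \<in> D \<Longrightarrow> u \<in> V" "(u, v) \<in> D \<Longrightarrow> v \<in> V"
  using D_imp_E E_verts(1) by blast+

lemma D_trans: "(u, v) \<in> D \<Longrightarrow> (v, w) \<in> D \<Longrightarrow> (u, w) \<in> D"
  using trans_D by (rule transD)

lemma D_asym: "(u, v) \<in> D \<Longrightarrow> (v, u) \<notin> D"
  using antisymmetric by auto

lemma ex_linear_extension_of_key:
  fixes key :: "'a \<Rightarrow> 'k::linorder"
  assumes "\<And>u v. (u, v) \<in> D \<Longrightarrow> key u \<le> key v"
  obtains p where "linear_extension V D p"
    and "\<And>u v. \<lbrakk>u \<in> V; v \<in> V; key u < key v\<rbrakk> \<Longrightarrow> precedes p u v"
proof (rule ex_linear_extension_refining[of V D key])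
  show "D \<subseteq> V \<times> V"
    using D_verts by auto
  show "irrefl D"
    using D_asym unfolding irrefl_def by blast
qed (use assms finite_V trans_D that in auto)

lemma outer_neighbours_same_label:
  assumes "(x, a) \<in> D" "(a, y) \<in> D" "\<pi> x \<noteq> \<pi> a" "\<pi> y \<noteq> \<pi> a"
  shows "\<pi> x = \<pi> y"
proof (rule ccontr)
  assume "\<pi> x \<noteq> \<pi> y"
  moreover have "(x, y) \<in> D"
    using assms(1,2) by (rule D_trans)
  ultimately have "(\<pi> x, \<pi> a) \<in> label_edges E \<pi>" "(\<pi> a, \<pi> y) \<in> label_edges E \<pi>"
    "(\<pi> x, \<pi> y) \<in> label_edges E \<pi>"
    using assms by (auto intro!: label_edgesI D_imp_E(1))
  then show False
    by (rule no_label_triangle)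
qed

definition below_other_part :: "'a \<Rightarrow> bool" where
  "below_other_part v \<longleftrightarrow> (\<exists>y. (v, y) \<in> D \<and> \<pi> y \<noteq> \<pi> v)"

definition above_other_part :: "'a \<Rightarrow> bool" where
  "above_other_part v \<longleftrightarrow> (\<exists>x. (x, v) \<in> D \<and> \<pi> x \<noteq> \<pi> v)"

text \<open>
  The third extension places \<open>v\<close> among the vertices with label \<open>level v\<close>, just before the lowest of
  its upper bounds there.
\<close>

definition below_parent_part :: "'a \<Rightarrow> bool" where
  "below_parent_part v \<longleftrightarrow> (\<exists>y. (v, y) \<in> D \<and> \<pi> y < \<pi> v)"

definition level :: "'a \<Rightarrow> nat" where
  "level v = (if below_parent_part v then label_parent (\<pi> v) else \<pi> v)"

definition upper_bounds :: "'a \<Rightarrow> 'a set" where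
  "upper_bounds v = {a \<in> V. \<pi> a = level v \<and> (a = v \<or> (v, a) \<in> D)}"

lemma level_le_label: "v \<in> V \<Longrightarrow> level v \<le> \<pi> v"
  using parent_less[OF label_pos] by (auto simp: level_def less_imp_le)

lemma level_eq_label: "\<not> below_other_part v \<Longrightarrow> level v = \<pi> v"
  by (auto simp: level_def below_other_part_def below_parent_part_def)

lemma level_mono:
  assumes less: "(u, v) \<in> D"
  shows "level u \<le> level v"
  using D_imp_E(1)[OF less]
proof (cases rule: edge_label_cases)
  case same
  have "below_parent_part u" if "below_parent_part v"
    using that same less unfolding below_parent_part_def by (metis D_trans)
  then show ?thesis
    using same level_le_label[OF D_verts(1)[OF less]] by (auto simp: level_def)
next
  case up
  then have "below_parent_part u"
    using less by (auto simp: below_parent_part_def)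
  moreover have "\<not> below_parent_part v"
  proof
    assume "below_parent_part v"
    then obtain w where "(v, w) \<in> D" "\<pi> w < \<pi> v"
      by (auto simp: below_parent_part_def)
    then show False
      using outer_neighbours_same_label[OF less] up by fastforce
  qed
  ultimately show ?thesis
    using up by (simp add: level_def descent_iff)
next
  case down
  have "level u \<le> \<pi> u"
    using D_verts(1)[OF less] by (rule level_le_label)
  also have "\<dots> \<le> level v"
    using down by (auto simp: level_def descent_iff)
  finally show ?thesis .
qed

lemma finite_upper_bounds: "finite (upper_bounds v)"
  unfolding upper_bounds_def using finite_V by simp

lemma upper_bounds_antimono: "(u, v) \<in> D \<Longrightarrow> level u = level v \<Longrightarrow> upper_bounds v \<subseteq> upper_bounds u"
  by (auto simp: upper_bounds_def dest: D_trans)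

lemma upper_bounds_nonadjacent_psubset:
  assumes "a \<in> V" "(a, z) \<notin> E" "level a = \<pi> a" "level z = \<pi> a" "\<pi> a \<noteq> \<pi> z"
  shows "upper_bounds z \<subset> upper_bounds a"
proof -
  have "b \<in> upper_bounds a \<and> b \<noteq> a" if "b \<in> upper_bounds z" for b
  proof -
    have b: "(z, b) \<in> D" "b \<in> V" "\<pi> b = \<pi> a"
      using that assms(4,5) by (auto simp: upper_bounds_def)
    have "b \<noteq> a" "(b, a) \<notin> D"
      using b(1) assms(2) by (auto dest: D_imp_E D_trans)
    then show ?thesis
      using same_part[OF assms(1) b(2)] E_cases b assms(3) by (auto simp: upper_bounds_def)
  qed
  moreover have "a \<in> upper_bounds a"
    using assms(1,3) by (simp add: upper_bounds_def)
  ultimately show ?thesis by blast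
qed

lemma linear_extension_descendants_above:
  obtains p where "linear_extension V D p"
    and "\<And>a z. \<lbrakk>a \<in> V; z \<in> V; (a, z) \<notin> E; (\<pi> a, \<pi> z) \<in> descent\<^sup>+; \<not> below_other_part a\<rbrakk>
      \<Longrightarrow> precedes p a z"
proof -
  \<comment> \<open>In a chain, fewer upper bounds mean a higher lowest one.\<close>
  define key where "key v = (level v, - int (card (upper_bounds v)))" for v
  have mono: "key u \<le> key v" if less: "(u, v) \<in> D" for u v
    using level_mono[OF less] card_mono[OF finite_upper_bounds upper_bounds_antimono[OF less]]
    by (cases "level u = level v") (simp_all add: key_def)
  have strict: "key a < key z"
    if "a \<in> V" "(a, z) \<notin> E" and descendant: "(\<pi> a, \<pi> z) \<in> descent\<^sup>+" and top: "\<not> below_other_part a"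
    for a z
  proof (cases "level z = \<pi> a")
    case True
    then have "card (upper_bounds z) < card (upper_bounds a)"
      using upper_bounds_nonadjacent_psubset[OF that(1,2) level_eq_label[OF top]]
        trancl_descent_less[OF descendant]
      by (intro psubset_card_mono finite_upper_bounds) simp
    with True show ?thesis
      by (simp add: key_def level_eq_label[OF top])
  next
    case False
    have "\<pi> a \<le> level z"
      using trancl_descent_le_parent[OF descendant] trancl_descent_less[OF descendant]
      by (simp add: level_def)
    with False show ?thesis
      by (simp add: key_def level_eq_label[OF top])
  qed
  show thesis
    by (rule ex_linear_extension_of_key[OF mono]) (auto intro: that strict)
qed

lemma linear_extension_descendants_below:
  obtains p where "linear_extension V D p"
    and "\<And>a z. \<lbrakk>a \<in> V; z \<in> V; (a, z) \<notin> E; (\<pi> a, \<pi> z) \<in> descent\<^sup>+; \<not> above_other_part a\<rbrakk>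
      \<Longrightarrow> precedes p z a"
proof -
  interpret dual: layered_orientation V E \<pi> "D\<inverse>"
    by (rule layered_orientation_converse)
  have "\<not> dual.below_other_part a" if "\<not> above_other_part a" for a
    using that by (simp add: above_other_part_def dual.below_other_part_def)
  moreover obtain p where "linear_extension V (D\<inverse>) p"
    and "\<And>a z. \<lbrakk>a \<in> V; z \<in> V; (a, z) \<notin> E; (\<pi> a, \<pi> z) \<in> descent\<^sup>+; \<not> dual.below_other_part a\<rbrakk>
      \<Longrightarrow> precedes p a z"
    using dual.linear_extension_descendants_above by blast
  ultimately show thesis
    by (intro that[of "rev p"]) (simp_all add: linear_extension_rev precedes_rev)
qed

end

section \<open>Four linear extensions\<close>

definition sandwiched :: "'a rel \<Rightarrow> ('a \<Rightarrow> 'b) \<Rightarrow> 'a \<Rightarrow> 'a \<Rightarrow> 'a \<Rightarrow> bool" where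
  "sandwiched D \<pi> x a y \<longleftrightarrow> (x, a) \<in> D \<and> (a, y) \<in> D \<and> \<pi> x = \<pi> y \<and> \<pi> x \<noteq> \<pi> a"

locale reduced_orientation = layered_orientation +
  assumes reduced: "(i, j) \<in> label_edges E \<pi> \<Longrightarrow> \<exists>u\<in>V. \<exists>v\<in>V. \<pi> u = i \<and> \<pi> v = j \<and> (u, v) \<notin> E"
begin

lemma reduced_orientation_converse: "reduced_orientation V E \<pi> (D\<inverse>)"
  using layered_orientation_converse reduced
  by (simp add: reduced_orientation_def reduced_orientation_axioms_def)

lemma sandwiched_adjacent:
  assumes sandwich: "sandwiched D \<pi> x a y" and c: "c \<in> V" "\<pi> c = \<pi> a"
  shows "(x, c) \<in> E"
proof (cases "c = a")
  case True
  with sandwich show ?thesis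
    by (auto simp: sandwiched_def dest: D_imp_E)
next
  case False
  have a: "(x, a) \<in> D" "(a, y) \<in> D" "\<pi> x = \<pi> y" "\<pi> x \<noteq> \<pi> a"
    using sandwich by (auto simp: sandwiched_def)
  have "(c, a) \<in> D \<or> (a, c) \<in> D"
    using same_part[OF c(1) D_verts(2)[OF a(1)] False c(2)] by (rule E_cases)
  then have "(y, c) \<in> E \<or> (x, c) \<in> E"
    using a D_trans D_imp_E by blast
  then show ?thesis
    using product[OF D_imp_E(1)[OF a(1)], of y c] a c(2) by auto
qed

lemma sandwiched_part_above:
  assumes sandwich: "sandwiched D \<pi> x a y" and c: "c \<in> V" "\<pi> c = \<pi> a"
  shows "(x, c) \<in> D"
proof (rule ccontr)
  assume "(x, c) \<notin> D"
  then have "(c, x) \<in> D"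
    using sandwiched_adjacent[OF sandwich c] E_cases by blast
  have xa: "(x, a) \<in> D" "\<pi> x \<noteq> \<pi> a"
    using sandwich by (auto simp: sandwiched_def)
  obtain b d where b: "b \<in> V" "\<pi> b = \<pi> x" and d: "d \<in> V" "\<pi> d = \<pi> a" and bd: "(b, d) \<notin> E"
    using reduced[OF label_edgesI[OF D_imp_E(1)[OF xa(1)] xa(2)]] by blast
  have nonadjacent: "(b, e) \<notin> E" if "e \<in> V" "\<pi> e = \<pi> a" for e
    using product[of b e x d] sandwiched_adjacent[OF sandwich d] b bd d(2) that xa(2) by auto
  then have "b \<noteq> x"
    using sandwiched_adjacent[OF sandwich c] c by blast
  \<comment> \<open>Either \<open>b < x < a\<close> or \<open>c < x < b\<close>, but \<open>b\<close> has no neighbour in the part of \<open>a\<close>.\<close>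
  then consider "(b, x) \<in> D" | "(x, b) \<in> D"
    using same_part[OF b(1) D_verts(1)[OF xa(1)]] b(2) E_cases by blast
  then show False
    using nonadjacent[OF c] nonadjacent[OF D_verts(2)[OF xa(1)]] \<open>(c, x) \<in> D\<close> xa(1) D_trans D_imp_E
    by cases blast+
qed

lemma sandwiched_part:
  assumes sandwich: "sandwiched D \<pi> x a y" and c: "c \<in> V" "\<pi> c = \<pi> a"
  shows "sandwiched D \<pi> x c y"
proof -
  interpret dual: reduced_orientation V E \<pi> "D\<inverse>"
    by (rule reduced_orientation_converse)
  have "(c, y) \<in> D"
    using dual.sandwiched_part_above[of y a x c] sandwich c by (auto simp: sandwiched_def)
  with sandwiched_part_above[OF assms] show ?thesis
    using sandwich c by (simp add: sandwiched_def)
qed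

lemma sandwiched_label_edge:
  assumes sandwich: "sandwiched D \<pi> x a y" and edge: "(\<pi> a, j) \<in> label_edges E \<pi>"
  shows "j = \<pi> x"
proof (rule ccontr)
  assume "j \<noteq> \<pi> x"
  obtain c d where cd: "(c, d) \<in> E" "\<pi> c = \<pi> a" "\<pi> d = j"
    using edge by (elim label_edgesE)
  have c: "(x, c) \<in> D" "(c, y) \<in> D" "\<pi> y = \<pi> x"
    using sandwiched_part[OF sandwich E_verts(1)[OF cd(1)] cd(2)] by (auto simp: sandwiched_def)
  from E_cases[OF cd(1)] have "(x, d) \<in> E \<or> (y, d) \<in> E"
    using c D_trans D_imp_E by blast
  then have "(\<pi> x, j) \<in> label_edges E \<pi>"
    using \<open>j \<noteq> \<pi> x\<close> c(3) cd(3) label_edgesI by metis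
  moreover have "(\<pi> x, \<pi> a) \<in> label_edges E \<pi>"
    using sandwich unfolding sandwiched_def by (intro label_edgesI D_imp_E(1)) blast+
  ultimately show False
    using no_label_triangle edge by blast
qed

lemma sandwiching_label_not_sandwiched:
  assumes inner: "sandwiched D \<pi> x a y" and outer: "sandwiched D \<pi> z b w"
  shows "\<pi> z \<noteq> \<pi> a"
proof
  assume same: "\<pi> z = \<pi> a"
  have zb: "(z, b) \<in> D" "\<pi> z \<noteq> \<pi> b"
    using outer by (auto simp: sandwiched_def)
  then have "\<pi> b = \<pi> x"
    using sandwiched_label_edge[OF inner] label_edgesI[OF D_imp_E(1)] same by metis
  moreover have "x \<in> V"
    using inner D_verts by (auto simp: sandwiched_def)
  ultimately have "(z, x) \<in> D"
    using sandwiched_part[OF outer] by (simp add: sandwiched_def)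
  moreover have "(x, z) \<in> D"
    using sandwiched_part[OF inner D_verts(1)[OF zb(1)] same] by (simp add: sandwiched_def)
  ultimately show False
    using D_asym by blast
qed

end

locale normal_orientation = reduced_orientation +
  assumes sandwiched_label_greater: "sandwiched D \<pi> x a y \<Longrightarrow> \<pi> x < \<pi> a"
begin

lemma not_above_and_below_other_parts:
  assumes "above_other_part a" and descendant: "(\<pi> a, k) \<in> descent\<^sup>+"
  shows "\<not> below_other_part a"
proof
  assume "below_other_part a"
  then obtain x y where xay: "(x, a) \<in> D" "(a, y) \<in> D" "\<pi> x \<noteq> \<pi> a" "\<pi> y \<noteq> \<pi> a"
    using assms(1) by (auto simp: above_other_part_def below_other_part_def)
  then have sandwich: "sandwiched D \<pi> x a y"
    using outer_neighbours_same_label by (simp add: sandwiched_def)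
  obtain m where "0 < m" "\<pi> a = label_parent m"
    using tranclD[OF descendant] by (auto simp: descent_iff)
  moreover have "\<pi> a \<noteq> 0"
    using label_pos[OF D_verts(2)[OF xay(1)]] by simp
  ultimately have "(\<pi> a, m) \<in> label_edges E \<pi>" "\<pi> a < m"
    by (metis label_parent_cases)+
  then show False
    using sandwiched_label_edge[OF sandwich] sandwiched_label_greater[OF sandwich] by fastforce
qed

definition gap_pos :: "real \<Rightarrow> 'a \<Rightarrow> real" where
  "gap_pos s v = centre s (\<pi> v) + (if below_other_part v then -1 else 1) * (1/4) ^ \<pi> v"

lemma gap_pos_bounds:
  "centre s (\<pi> v) - (1/4) ^ \<pi> v \<le> gap_pos s v" "gap_pos s v \<le> centre s (\<pi> v) + (1/4) ^ \<pi> v"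
  by (simp_all add: gap_pos_def)

lemma gap_pos_descendant:
  assumes "\<bar>s\<bar> = 1" "(\<pi> a, \<pi> z) \<in> descent\<^sup>+"
  shows "if below_other_part a then gap_pos s a < gap_pos s z else gap_pos s z < gap_pos s a"
  using intervals_strictly_nested[OF assms] gap_pos_bounds[of s z]
  by (auto simp: gap_pos_def[of s a])

lemma gap_pos_crossed:
  assumes "crossed (\<pi> u) (\<pi> v)"
  shows "gap_pos 1 u < gap_pos 1 v" "gap_pos (-1) v < gap_pos (-1) u"
  using assms gap_pos_bounds[of _ u] gap_pos_bounds[of _ v]
  unfolding crossed_def by (meson le_less_trans less_le_trans)+

lemma gap_pos_mono:
  assumes s: "\<bar>s\<bar> = 1" and less: "(u, v) \<in> D"
  shows "gap_pos s u \<le> gap_pos s v"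
  using D_imp_E(1)[OF less]
proof (cases rule: edge_label_cases)
  case same
  have "below_other_part u" if "below_other_part v"
    using that less same unfolding below_other_part_def by (metis D_trans)
  with same show ?thesis
    by (auto simp: gap_pos_def)
next
  case up
  have "above_other_part v"
    using less up(1) by (auto simp: above_other_part_def)
  then have "\<not> below_other_part v"
    by (rule not_above_and_below_other_parts[OF _ r_into_trancl[OF up(2)]])
  with gap_pos_descendant[OF s r_into_trancl[OF up(2)]] show ?thesis by simp
next
  case down
  then have "below_other_part u"
    using less by (auto simp: below_other_part_def)
  with gap_pos_descendant[OF s r_into_trancl[OF down(2)]] show ?thesis by simp
qed

lemma linear_extension_gap_pos:
  assumes "\<bar>s\<bar> = 1"
  obtains p where "linear_extension V D p"
    and "\<And>u v. \<lbrakk>u \<in> V; v \<in> V; gap_pos s u < gap_pos s v\<rbrakk> \<Longrightarrow> precedes p u v"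
  by (rule ex_linear_extension_of_key[of "gap_pos s"])
    (rule gap_pos_mono[OF assms], assumption, rule that)

lemma nonadjacent_cases:
  assumes "u \<in> V" "v \<in> V" "u \<noteq> v" "(u, v) \<notin> E"
  obtains (forward) "gap_pos 1 u < gap_pos 1 v"
  | (backward) "gap_pos (-1) u < gap_pos (-1) v"
  | (top) "(\<pi> u, \<pi> v) \<in> descent\<^sup>+" "\<not> below_other_part u"
  | (bottom) "(\<pi> v, \<pi> u) \<in> descent\<^sup>+" "\<not> above_other_part v"
proof -
  have "\<pi> u \<noteq> \<pi> v"
    using same_part assms by blast
  then consider (down) "(\<pi> u, \<pi> v) \<in> descent\<^sup>+" | (up) "(\<pi> v, \<pi> u) \<in> descent\<^sup>+"
    | (crossed) "crossed (\<pi> u) (\<pi> v) \<or> crossed (\<pi> v) (\<pi> u)"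
    using crossed_or_descent by blast
  then show thesis
  proof cases
    case down
    show thesis
    proof (cases "below_other_part u")
      case True
      with gap_pos_descendant[of 1, OF _ down] forward show thesis by simp
    qed (rule top[OF down])
  next
    case up
    show thesis
    proof (cases "above_other_part v")
      case True
      then have "\<not> below_other_part v"
        using up by (rule not_above_and_below_other_parts)
      with gap_pos_descendant[of 1, OF _ up] forward show thesis by simp
    qed (rule bottom[OF up])
  next
    case crossed
    then show thesis
      using gap_pos_crossed forward backward by blast
  qed
qed

lemma ex_realizer_of_size_4:
  obtains ps where "length ps = 4" "realizer V D ps"
proof -
  obtain p1 where p1: "linear_extension V D p1"
    "\<And>u v. \<lbrakk>u \<in> V; v \<in> V; gap_pos 1 u < gap_pos 1 v\<rbrakk> \<Longrightarrow> precedes p1 u v"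
    by (rule linear_extension_gap_pos[of 1]) (simp, blast)
  obtain p2 where p2: "linear_extension V D p2"
    "\<And>u v. \<lbrakk>u \<in> V; v \<in> V; gap_pos (-1) u < gap_pos (-1) v\<rbrakk> \<Longrightarrow> precedes p2 u v"
    by (rule linear_extension_gap_pos[of "-1"]) (simp, blast)
  obtain p3 where p3: "linear_extension V D p3"
    "\<And>a z. \<lbrakk>a \<in> V; z \<in> V; (a, z) \<notin> E; (\<pi> a, \<pi> z) \<in> descent\<^sup>+; \<not> below_other_part a\<rbrakk>
      \<Longrightarrow> precedes p3 a z"
    using linear_extension_descendants_above by blast
  obtain p4 where p4: "linear_extension V D p4"
    "\<And>a z. \<lbrakk>a \<in> V; z \<in> V; (a, z) \<notin> E; (\<pi> a, \<pi> z) \<in> descent\<^sup>+; \<not> above_other_part a\<rbrakk>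
      \<Longrightarrow> precedes p4 z a"
    using linear_extension_descendants_below by blast
  let ?ps = "[p1, p2, p3, p4]"
  have "\<exists>p\<in>set ?ps. precedes p u v"
    if verts: "u \<in> V" "v \<in> V" "u \<noteq> v" and incomparable: "(u, v) \<notin> D" "(v, u) \<notin> D" for u v
  proof -
    have nonadjacent: "(u, v) \<notin> E" "(v, u) \<notin> E"
      using incomparable E_cases by blast+
    from verts nonadjacent(1) show ?thesis
      using p1(2) p2(2) p3(2) p4(2) verts nonadjacent by (cases rule: nonadjacent_cases) auto
  qed
  moreover have "\<forall>p\<in>set ?ps. linear_extension V D p"
    using p1(1) p2(1) p3(1) p4(1) by simp
  ultimately show thesis
    by (intro that[of ?ps]) (simp, unfold realizer_def, blast)
qed

end

section \<open>Normalising a layering\<close>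

context layered
begin

lemma smaller_label_edge_if_merged:
  assumes jk: "(j, k) \<in> label_edges E \<pi>" "j < k"
    and edge: "(i, n) \<in> label_edges E (id(k := j) \<circ> \<pi>)" "i < n"
  obtains m where "(m, n) \<in> label_edges E \<pi>" "m < n" "(id(k := j)) m = i"
proof -
  obtain m n' where mn: "(m, n') \<in> label_edges E \<pi>" "(id(k := j)) m = i" "(id(k := j)) n' = n"
    using edge(1) by (rule label_edges_compE)
  have "n' \<noteq> k"
  proof
    assume "n' = k"
    then have "m < j"
      using mn(2,3) edge(2) jk(2) by (auto split: if_splits)
    then show False
      using smaller_label_unique[OF _ jk(1), of m] mn(1) jk(2) \<open>n' = k\<close> by simp
  qed
  then have "n' = n"
    using mn(3) by simp
  have "m < n"
  proof (cases "m = k")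
    case True
    then have "j < n"
      using mn(2) edge(2) by simp
    then have "\<not> n < k"
      using smaller_label_unique[OF jk(1) label_edges_sym] mn(1) jk(2) True \<open>n' = n\<close> by blast
    with True \<open>n' \<noteq> k\<close> \<open>n' = n\<close> show ?thesis by simp
  next
    case False
    with mn(2) edge(2) show ?thesis by simp
  qed
  with mn(1,2) \<open>n' = n\<close> show thesis
    by (intro that) auto
qed

lemma same_label_if_merged:
  assumes jk: "(j, k) \<in> label_edges E \<pi>" "j < k"
    and arcs: "(u, v) \<in> E" "(u', v') \<in> E"
    and merged: "(id(k := j)) (\<pi> u) = (id(k := j)) (\<pi> u')"
      "(id(k := j)) (\<pi> v) = (id(k := j)) (\<pi> v')"
      "(id(k := j)) (\<pi> u) \<noteq> (id(k := j)) (\<pi> v)"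
  shows "\<pi> u = \<pi> u'"
proof (rule ccontr)
  assume "\<pi> u \<noteq> \<pi> u'"
  then have "{\<pi> u, \<pi> u'} = {j, k}" "\<pi> v' = \<pi> v" "\<pi> v \<noteq> j" "\<pi> v \<noteq> k"
    using merged by (auto split: if_splits)
  then have "(j, \<pi> v) \<in> label_edges E \<pi>" "(k, \<pi> v) \<in> label_edges E \<pi>"
    using label_edgesI[OF arcs(1), of \<pi>] label_edgesI[OF arcs(2), of \<pi>]
    by (auto simp: doubleton_eq_iff)
  then show False
    using no_label_triangle[OF jk(1)] by blast
qed

lemma layered_merge:
  assumes jk: "(j, k) \<in> label_edges E \<pi>" "j < k"
    and clique: "\<And>u v. \<lbrakk>u \<in> V; v \<in> V; \<pi> u = j; \<pi> v = k\<rbrakk> \<Longrightarrow> (u, v) \<in> E"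
  shows "layered V E (id(k := j) \<circ> \<pi>)"
proof
  let ?\<rho> = "id(k := j) \<circ> \<pi>"
  have "0 < j"
    using label_edges_image(1)[OF jk(1)] label_pos by auto
  then show "0 < ?\<rho> v" if "v \<in> V" for v
    using label_pos[OF that] by simp
  show "(u, v) \<in> E" if "u \<in> V" "v \<in> V" "u \<noteq> v" "?\<rho> u = ?\<rho> v" for u v
    using that same_part[of u v] clique[of u v] sym_E[OF clique[of v u]]
    by (auto split: if_splits)
  show "i = i'"
    if i: "(i, n) \<in> label_edges E ?\<rho>" "i < n" and i': "(i', n) \<in> label_edges E ?\<rho>" "i' < n"
    for i i' n
    using smaller_label_edge_if_merged[OF jk i] smaller_label_edge_if_merged[OF jk i']
      smaller_label_unique by metis
  show "(u, v') \<in> E"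
    if arcs: "(u, v) \<in> E" "(u', v') \<in> E"
      and merged: "?\<rho> u = ?\<rho> u'" "?\<rho> v = ?\<rho> v'" "?\<rho> u \<noteq> ?\<rho> v" for u v u' v'
  proof (rule product[OF arcs])
    show "\<pi> u = \<pi> u'"
      using same_label_if_merged[OF jk arcs] merged by simp
    show "\<pi> v = \<pi> v'"
      using same_label_if_merged[OF jk arcs[THEN sym_E]] merged by simp
    show "\<pi> u \<noteq> \<pi> v"
      using merged(3) by (metis comp_apply)
  qed
qed (fact finite_V E_subset sym_E)+

lemma card_merge_less:
  assumes "(j, k) \<in> label_edges E \<pi>"
  shows "card ((id(k := j) \<circ> \<pi>) ` V) < card (\<pi> ` V)"
proof (rule psubset_card_mono)
  show "finite (\<pi> ` V)"
    using finite_V by simp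
  have "j \<noteq> k"
    using assms by (auto elim: label_edgesE)
  then have "(id(k := j) \<circ> \<pi>) ` V \<subseteq> \<pi> ` V - {k}"
    using label_edges_image(1)[OF assms] by auto
  with label_edges_image(2)[OF assms] show "(id(k := j) \<circ> \<pi>) ` V \<subset> \<pi> ` V"
    by blast
qed

end

lemma (in layered_orientation) ex_reduced_orientation:
  obtains \<rho> where "reduced_orientation V E \<rho> D"
proof -
  obtain \<rho> where "layered V E \<rho>"
    and minimal: "\<And>\<sigma>. layered V E \<sigma> \<Longrightarrow> card (\<rho> ` V) \<le> card (\<sigma> ` V)"
    using ex_has_least_nat[of "layered V E" \<pi> "\<lambda>\<sigma>. card (\<sigma> ` V)"] layered_axioms by blast
  interpret \<rho>: layered V E \<rho> by fact
  have nonadjacent: "\<exists>u\<in>V. \<exists>v\<in>V. \<rho> u = i \<and> \<rho> v = j \<and> (u, v) \<notin> E"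
    if edge: "(i, j) \<in> label_edges E \<rho>" "i < j" for i j
  proof (rule ccontr)
    assume "\<not> ?thesis"
    then have "layered V E (id(j := i) \<circ> \<rho>)"
      by (intro \<rho>.layered_merge[OF edge]) blast
    then show False
      using minimal \<rho>.card_merge_less[OF edge(1)] by (meson not_le)
  qed
  have "reduced_orientation V E \<rho> D"
  proof
    show "\<exists>u\<in>V. \<exists>v\<in>V. \<rho> u = i \<and> \<rho> v = j \<and> (u, v) \<notin> E"
      if edge: "(i, j) \<in> label_edges E \<rho>" for i j
    proof (cases "i < j")
      case True
      with edge show ?thesis by (rule nonadjacent)
    next
      case False
      then have "j < i"
        using edge by (auto elim: label_edgesE)
      from nonadjacent[OF \<rho>.label_edges_sym[OF edge] this] show ?thesis
        using sym_E by blast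
    qed
  qed (fact orientation antisymmetric trans_D)+
  then show thesis by (rule that)
qed

context reduced_orientation
begin

definition sandwiched_label :: "nat \<Rightarrow> bool" where
  "sandwiched_label i \<longleftrightarrow> (\<exists>x a y. sandwiched D \<pi> x a y \<and> \<pi> a = i)"

definition raise :: "nat \<Rightarrow> nat \<Rightarrow> nat" where
  "raise N i = (if sandwiched_label i then i + N else i)"

lemma inj_on_raise:
  assumes "\<And>v. v \<in> V \<Longrightarrow> \<pi> v < N"
  shows "inj_on (raise N) (\<pi> ` V)"
  using assms by (fastforce simp: inj_on_def raise_def)

lemma sandwiched_label_neighbour_unique:
  assumes "sandwiched_label n" "(i, n) \<in> label_edges E \<pi>" "(j, n) \<in> label_edges E \<pi>"
  shows "i = j"
  using assms sandwiched_label_edge label_edges_sym unfolding sandwiched_label_def by metis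

lemma layered_raise:
  assumes bound: "\<And>v. v \<in> V \<Longrightarrow> \<pi> v < N"
  shows "layered V E (raise N \<circ> \<pi>)"
proof (intro layered.intro layered_axioms.intro)
  show "product_clique_partition V E (raise N \<circ> \<pi>)"
    using inj_on_raise[OF bound] by (rule product_clique_partition_relabel)
  show "0 < (raise N \<circ> \<pi>) v" if "v \<in> V" for v
    using label_pos[OF that] by (simp add: raise_def)
  fix i j k
  assume edges: "(i, k) \<in> label_edges E (raise N \<circ> \<pi>)" "(j, k) \<in> label_edges E (raise N \<circ> \<pi>)"
    and less: "i < k" "j < k"
  obtain i' n where i': "(i', n) \<in> label_edges E \<pi>" "raise N i' = i" "raise N n = k"
    using edges(1) by (rule label_edges_compE)
  obtain j' n' where j': "(j', n') \<in> label_edges E \<pi>" "raise N j' = j" "raise N n' = k"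
    using edges(2) by (rule label_edges_compE)
  have "n' = n"
    using inj_onD[OF inj_on_raise[OF bound]] i'(3) j'(3) label_edges_image(2) i'(1) j'(1) by metis
  have "i' = j'"
  proof (cases "sandwiched_label n")
    case True
    then show ?thesis
      using i'(1) j'(1) \<open>n' = n\<close> by (blast intro: sandwiched_label_neighbour_unique)
  next
    case False
    then have "k = n" "n < N"
      using i'(3) bound label_edges_image(2)[OF i'(1)] by (auto simp: raise_def)
    then have "i' < n" "j' < n"
      using i'(2) j'(2) less by (auto simp: raise_def split: if_splits)
    then show ?thesis
      using smaller_label_unique i'(1) j'(1) \<open>n' = n\<close> by blast
  qed
  then show "i = j"
    using i'(2) j'(2) by simp
qed

lemma ex_normal_orientation:
  obtains \<rho> where "normal_orientation V E \<rho> D"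
proof -
  obtain N where bound: "\<And>v. v \<in> V \<Longrightarrow> \<pi> v < N"
    using finite_V finite_nat_set_iff_bounded[of "\<pi> ` V"] by auto
  let ?\<rho> = "raise N \<circ> \<pi>"
  interpret \<rho>: layered V E ?\<rho>
    using bound by (rule layered_raise)
  have "normal_orientation V E ?\<rho> D"
  proof
    show "\<exists>u\<in>V. \<exists>v\<in>V. ?\<rho> u = i \<and> ?\<rho> v = j \<and> (u, v) \<notin> E"
      if edge: "(i, j) \<in> label_edges E ?\<rho>" for i j
      using edge by (rule label_edges_compE) (use reduced in fastforce)
    show "?\<rho> x < ?\<rho> a" if raised: "sandwiched D ?\<rho> x a y" for x a y
    proof -
      have verts: "x \<in> V" "y \<in> V"
        using raised D_verts by (auto simp: sandwiched_def)
      then have sandwich: "sandwiched D \<pi> x a y"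
        using raised inj_onD[OF inj_on_raise[OF bound], of "\<pi> x" "\<pi> y"]
        by (auto simp: sandwiched_def)
      then have "\<not> sandwiched_label (\<pi> x)" "sandwiched_label (\<pi> a)"
        using sandwiching_label_not_sandwiched unfolding sandwiched_label_def by metis+
      then show ?thesis
        using bound[OF verts(1)] by (simp add: raise_def)
    qed
  qed (fact orientation antisymmetric trans_D)+
  then show thesis by (rule that)
qed

end

section \<open>Numbering the parts of a well-partitioned chordal graph\<close>

lemma (in pair_graph) acyclic_path_meets_neighbours_once:
  assumes acyclic: "\<not> (\<exists>p. cycle p \<and> 3 \<le> length p)"
    and path: "apath u p v" and x: "(x, u) \<in> parcs G" "x \<in> set (pawalk_verts u p)"
  shows "x = snd (hd p)"
proof -
  obtain q r where split: "p = q @ r" "awalk u q x"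
    using awalk_decomp[of u p v x] path x(2) by (auto simp: apath_def)
  have "q \<noteq> []"
    using split(2) no_loops'[OF x(1)] by (auto simp: awalk_Nil_iff)
  have "distinct (pawalk_verts u q)"
    using path unfolding split(1) apath_append_iff by (simp only: apath_def)
  then have "cycle ((x, u) # q)"
    using split(2) x(1) unfolding cycle_def by (intro exI[of _ x]) (auto simp: awalk_Cons_iff)
  then have "length q < 2"
    using acyclic by fastforce
  with \<open>q \<noteq> []\<close> obtain e where "q = [e]"
    by (cases q) auto
  with split show ?thesis
    by (auto simp: awalk_simps)
qed

lemma (in pair_graph) ex_vertex_with_unique_neighbour:
  assumes acyclic: "\<not> (\<exists>p. cycle p \<and> 3 \<le> length p)" and S: "S \<subseteq> pverts G" "S \<noteq> {}"
  obtains u where "u \<in> S"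
    and "\<And>v w. \<lbrakk>v \<in> S; w \<in> S; (v, u) \<in> parcs G; (w, u) \<in> parcs G\<rbrakk> \<Longrightarrow> v = w"
proof -
  define path_in_S where "path_in_S p \<longleftrightarrow> (\<exists>u v. apath u p v \<and> set (pawalk_verts u p) \<subseteq> S)" for p
  obtain s where "s \<in> S"
    using S(2) by blast
  then have "path_in_S []"
    using S(1) unfolding path_in_S_def by (intro exI[of _ s]) (auto simp: apath_Nil_iff)
  moreover have "length p < Suc (card (pverts G))" if "path_in_S p" for p
    using that length_apath_less unfolding path_in_S_def by (meson less_SucI)
  ultimately obtain p where "path_in_S p" and longest: "\<And>q. path_in_S q \<Longrightarrow> length q \<le> length p"
    using ex_has_greatest_nat[of path_in_S "[]" length] by blast
  then obtain u v where path: "apath u p v" "set (pawalk_verts u p) \<subseteq> S"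
    by (auto simp: path_in_S_def)
  have "x \<in> set (pawalk_verts u p)" if x: "x \<in> S" "(x, u) \<in> parcs G" for x
  proof (rule ccontr)
    assume "x \<notin> set (pawalk_verts u p)"
    then have "path_in_S ((x, u) # p)"
      using path x unfolding path_in_S_def
      by (intro exI[of _ x] exI[of _ v]) (auto simp: apath_Cons_iff)
    then show False
      using longest by fastforce
  qed
  then have "x = snd (hd p)" if "x \<in> S" "(x, u) \<in> parcs G" for x
    using acyclic_path_meets_neighbours_once[OF acyclic path(1)] that by blast
  moreover have "u \<in> S"
    using path by (auto dest: hd_in_awalk_verts)
  ultimately show thesis
    by (intro that) auto
qed

lemma ex_numbering_with_unique_smaller_neighbour:
  assumes "finite S"
    and degenerate: "\<forall>U\<subseteq>S. U \<noteq> {} \<longrightarrow>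
      (\<exists>u\<in>U. \<forall>v\<in>U. \<forall>w\<in>U. (v, u) \<in> R \<longrightarrow> (w, u) \<in> R \<longrightarrow> v = w)"
  shows "\<exists>g :: 'a \<Rightarrow> nat. inj_on g S \<and>
    (\<forall>u\<in>S. \<forall>v\<in>S. \<forall>w\<in>S. (v, u) \<in> R \<longrightarrow> (w, u) \<in> R \<longrightarrow> g v < g u \<longrightarrow> g w < g u \<longrightarrow> v = w)"
  using assms(1)
proof (induction S rule: finite_remove_induct)
  case empty
  show ?case by simp
next
  case (remove U)
  obtain u where u: "u \<in> U" "\<forall>v\<in>U. \<forall>w\<in>U. (v, u) \<in> R \<longrightarrow> (w, u) \<in> R \<longrightarrow> v = w"
    using degenerate remove.hyps(2,3) by blast
  let ?U = "U - {u}"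
  obtain g :: "'a \<Rightarrow> nat" where g: "inj_on g ?U"
    "\<forall>x\<in>?U. \<forall>v\<in>?U. \<forall>w\<in>?U. (v, x) \<in> R \<longrightarrow> (w, x) \<in> R \<longrightarrow> g v < g x \<longrightarrow> g w < g x \<longrightarrow> v = w"
    using remove.IH[OF u(1)] by blast
  obtain N where bound: "\<forall>i\<in>g ` ?U. i < N"
    using remove.hyps(1) finite_nat_set_iff_bounded[of "g ` ?U"] by auto
  let ?g = "g(u := N)"
  have "inj_on ?g U"
    using g(1) bound by (auto simp: inj_on_def)
  moreover have "v = w"
    if "x \<in> U" "v \<in> U" "w \<in> U" and edges: "(v, x) \<in> R" "(w, x) \<in> R"
      and less: "?g v < ?g x" "?g w < ?g x" for x v w
  proof (cases "x = u")
    case True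
    with that u(2) show ?thesis by blast
  next
    case False
    then have "?g x < N"
      using bound that(1) by simp
    then have "v \<noteq> u" "w \<noteq> u"
      using less by auto
    with False that show ?thesis
      using g(2)[rule_format, of x v w] by simp
  qed
  ultimately show ?case by blast
qed

lemma undirected_tree_numbering:
  assumes "undirected_tree T"
  obtains g :: "'a \<Rightarrow> nat" where "inj_on g (pverts T)" "\<And>A. 0 < g A"
    and "\<And>A A' B. \<lbrakk>(A, B) \<in> parcs T; (A', B) \<in> parcs T; g A < g B; g A' < g B\<rbrakk> \<Longrightarrow> A = A'"
proof -
  interpret pair_graph T
    using assms by (simp add: undirected_tree_def connected_graph_def)
  have acyclic: "\<not> (\<exists>p. cycle p \<and> 3 \<le> length p)"
    using assms by (simp add: undirected_tree_def)
  have "\<forall>U\<subseteq>pverts T. U \<noteq> {} \<longrightarrow>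
    (\<exists>u\<in>U. \<forall>v\<in>U. \<forall>w\<in>U. (v, u) \<in> parcs T \<longrightarrow> (w, u) \<in> parcs T \<longrightarrow> v = w)"
  proof (intro allI impI)
    fix U assume "U \<subseteq> pverts T" "U \<noteq> {}"
    then show "\<exists>u\<in>U. \<forall>v\<in>U. \<forall>w\<in>U. (v, u) \<in> parcs T \<longrightarrow> (w, u) \<in> parcs T \<longrightarrow> v = w"
      by (rule ex_vertex_with_unique_neighbour[OF acyclic]) blast
  qed
  from ex_numbering_with_unique_smaller_neighbour[OF pair_finite_verts this]
  obtain g :: "'a \<Rightarrow> nat" where inj: "inj_on g (pverts T)"
    and unique: "\<forall>B\<in>pverts T. \<forall>A\<in>pverts T. \<forall>A'\<in>pverts T. (A, B) \<in> parcs T \<longrightarrow> (A', B) \<in> parcs T \<longrightarrow>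
      g A < g B \<longrightarrow> g A' < g B \<longrightarrow> A = A'"
    by (elim exE conjE) (rule that)
  show thesis
  proof (rule that[of "Suc \<circ> g"])
    show "inj_on (Suc \<circ> g) (pverts T)"
      using inj by (simp add: comp_inj_on)
    show "A = A'" if arcs: "(A, B) \<in> parcs T" "(A', B) \<in> parcs T"
      and less: "(Suc \<circ> g) A < (Suc \<circ> g) B" "(Suc \<circ> g) A' < (Suc \<circ> g) B" for A A' B
      using unique[rule_format, OF in_arcsD2[OF arcs(1)] in_arcsD1[OF arcs(1)]
          in_arcsD1[OF arcs(2)] arcs] less by simp
  qed simp
qed

lemma well_partitioned_chordalE:
  assumes "well_partitioned_chordal G"
  obtains T and part :: "'a \<Rightarrow> 'a set" where "undirected_tree T" "part ` pverts G \<subseteq> pverts T"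
    and "product_clique_partition (pverts G) (parcs G) part"
    and "label_edges (parcs G) part \<subseteq> parcs T"
proof -
  obtain P T where P: "partition_on (pverts G) P" and T: "undirected_tree T" "pverts T = P"
    and clique: "\<forall>A\<in>P. is_clique G A"
    and product: "\<forall>A B. (A, B) \<in> parcs T \<longrightarrow>
      (\<exists>A' B'. A' \<subseteq> A \<and> B' \<subseteq> B \<and> edges_between G A B = A' \<times> B')"
    and none: "\<forall>A\<in>P. \<forall>B\<in>P. A \<noteq> B \<and> (A, B) \<notin> parcs T \<longrightarrow> edges_between G A B = {}"
    using assms unfolding well_partitioned_chordal_def by (elim conjE exE) (rule that; assumption)
  interpret pair_graph G
    using assms by (simp add: well_partitioned_chordal_def connected_graph_def)
  have "\<forall>v\<in>pverts G. \<exists>A. A \<in> P \<and> v \<in> A"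
    using P by (auto simp: partition_on_def)
  then obtain part where part: "\<And>v. v \<in> pverts G \<Longrightarrow> part v \<in> P" "\<And>v. v \<in> pverts G \<Longrightarrow> v \<in> part v"
    by metis
  have between: "(u, v) \<in> edges_between G (part u) (part v)" if "(u, v) \<in> parcs G" for u v
    using that part(2) in_arcsD1[OF that] in_arcsD2[OF that] by (simp add: edges_between_def)
  have tree_arc: "(part u, part v) \<in> parcs T" if "(u, v) \<in> parcs G" "part u \<noteq> part v" for u v
    using between[OF that(1)] none part(1) in_arcsD1[OF that(1)] in_arcsD2[OF that(1)] that(2)
    by blast
  have "product_clique_partition (pverts G) (parcs G) part"
  proof
    show "finite (pverts G)" "parcs G \<subseteq> pverts G \<times> pverts G"
      using pair_finite_verts in_arcsD1 in_arcsD2 by auto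
    show "(v, u) \<in> parcs G" if "(u, v) \<in> parcs G" for u v
      using that by (rule arcs_symmetric)
    show "(u, v) \<in> parcs G" if "u \<in> pverts G" "v \<in> pverts G" "u \<noteq> v" "part u = part v" for u v
      using clique part that unfolding is_clique_def by metis
    show "(u, v') \<in> parcs G" if arcs: "(u, v) \<in> parcs G" "(u', v') \<in> parcs G"
      and same: "part u = part u'" "part v = part v'" and "part u \<noteq> part v" for u v u' v'
    proof -
      obtain A' B' where "edges_between G (part u) (part v) = A' \<times> B'"
        using product tree_arc[OF arcs(1) \<open>part u \<noteq> part v\<close>] by blast
      then have "(u, v') \<in> edges_between G (part u) (part v)"
        using between[OF arcs(1)] between[OF arcs(2)] same by auto
      then show ?thesis
        by (simp add: edges_between_def)
    qed
  qed
  with T part(1) tree_arc show thesis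
    by (intro that) (auto elim!: label_edgesE)
qed

lemma well_partitioned_chordal_layered:
  assumes "well_partitioned_chordal G"
  obtains \<pi> where "layered (pverts G) (parcs G) \<pi>"
proof -
  obtain T and part :: "'a \<Rightarrow> 'a set" where T: "undirected_tree T" "part ` pverts G \<subseteq> pverts T"
    and partition: "product_clique_partition (pverts G) (parcs G) part"
    and edges: "label_edges (parcs G) part \<subseteq> parcs T"
    using assms by (rule well_partitioned_chordalE)
  interpret product_clique_partition "pverts G" "parcs G" part by fact
  obtain g :: "'a set \<Rightarrow> nat" where inj: "inj_on g (pverts T)" and pos: "\<And>A. 0 < g A"
    and unique: "\<And>A A' B. \<lbrakk>(A, B) \<in> parcs T; (A', B) \<in> parcs T; g A < g B; g A' < g B\<rbrakk> \<Longrightarrow> A = A'"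
    by (rule undirected_tree_numbering[OF T(1)]) blast
  have "layered (pverts G) (parcs G) (g \<circ> part)"
  proof (intro layered.intro layered_axioms.intro)
    show "product_clique_partition (pverts G) (parcs G) (g \<circ> part)"
      using inj_on_subset[OF inj T(2)] by (rule product_clique_partition_relabel)
    show "0 < (g \<circ> part) v" for v
      using pos by simp
    fix i j k
    assume "(i, k) \<in> label_edges (parcs G) (g \<circ> part)" "(j, k) \<in> label_edges (parcs G) (g \<circ> part)"
      and less: "i < k" "j < k"
    then obtain A B A' B' where "(A, B) \<in> label_edges (parcs G) part" "g A = i" "g B = k"
      and "(A', B') \<in> label_edges (parcs G) part" "g A' = j" "g B' = k"
      by (elim label_edges_compE)
    moreover from this have "B' = B"
      using inj_onD[OF inj, of B' B] label_edges_image(2) T(2) by auto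
    ultimately show "i = j"
      using unique[of A B A'] edges less by auto
  qed
  then show thesis by (rule that)
qed

theorem theorem6:
  fixes G :: "'a pair_pre_digraph"
  assumes "well_partitioned_chordal G"
    and "comparability_graph G"
  shows "permutation_representation_number G \<le> 4"
proof -
  obtain D where D: "transitive_orientation G D"
    using assms(2) unfolding comparability_graph_def by blast
  obtain \<pi> where "layered (pverts G) (parcs G) \<pi>"
    using assms(1) by (rule well_partitioned_chordal_layered)
  then have "layered_orientation (pverts G) (parcs G) \<pi> D"
    using D by (simp add: layered_orientation_def layered_orientation_axioms_def
        transitive_orientation_def)
  then obtain \<rho> where "reduced_orientation (pverts G) (parcs G) \<rho> D"
    by (rule layered_orientation.ex_reduced_orientation)
  then obtain \<sigma> where "normal_orientation (pverts G) (parcs G) \<sigma> D"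
    by (rule reduced_orientation.ex_normal_orientation)
  then obtain ps where "length ps = 4" "realizer (pverts G) D ps"
    by (rule normal_orientation.ex_realizer_of_size_4)
  then have "permutationally_representable 4 G"
    using realizer_imp_permutationally_representable[OF D, of ps] by force
  then have "permutation_representation_number G \<le> enat 4"
    unfolding permutation_representation_number_def by (intro INF_lower) simp
  then show ?thesis
    by (simp add: numeral_eq_enat)
qed

end
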